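(* Let "$\square$-convergence" signify either EDP convergence with tilting (tilt-EDP convergence) or contact EDP convergence with tilting (contact-EDP convergence). Let $(\mathbf{Q},\mathcal{E}_\varepsilon,\mathcal{R}_\varepsilon)_{\varepsilon>0}$ be a family of gradient systems which $\square$-converges to a gradient system $(\mathbf{Q},\mathcal{E}_0,\mathcal{R}_0)$. Then for all $\widetilde{\mathcal{F}}\in C^1(\mathbf{Q})$ the family $(\mathbf{Q},\mathcal{E}_\varepsilon+\widetilde{\mathcal{F}},\mathcal{R}_\varepsilon)$ $\square$-converges to $(\mathbf{Q},\mathcal{E}_0+\widetilde{\mathcal{F}},\mathcal{R}_0)$, where the limiting dissipation potential $\mathcal{R}_0$ is the same for all $\widetilde{\mathcal{F}}$.
   Context: Gradient systems. A gradient system is a triple $(\mathbf{Q},\mathcal{E},\mathcal{R})$ where $\mathbf{Q}$ is a smooth finite-dimensional Riemannian manifold, $\mathcal{E}:\mathbf{Q}\to\mathbb{R}$ is continuously differentiable, and $\mathcal{R}:T\mathbf{Q}\to[0,\infty]$ is a dissipation potential: for each $q$, $\mathcal{R}(q,\cdot):T_q\mathbf{Q}\to[0,\infty]$ is convex and lower semicontinuous and $\mathcal{R}(q,0)=\min_v\mathcal{R}(q,v)=0$. Its dual is $\mathcal{R}^*(q,\xi)=\sup_{v\in T_q\mathbf{Q}}\langle\xi,v\rangle-\mathcal{R}(q,v)$. $T\mathbf{Q}\oplus T^*\mathbf{Q}$ is the set of triples $(q,v,\xi)$ with $q\in\mathbf{Q}$, $v\in T_q\mathbf{Q}$, $\xi\in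 T_q^*\mathbf{Q}$. All limits and $\Gamma$-limits are for $\varepsilon\to0$. $\mathrm{D}$ denotes the differential. Dissipation functionals. For $T>0$, $\mathcal{F}\in C^1(\mathbf{Q};\mathbb{R})$ and $q\in \mathrm{AC}([0,T];\mathbf{Q})$ put $$\mathfrak{D}_\varepsilon^T(q,\mathcal{F})=\int_0^T\Big[\mathcal{R}_\varepsilon(q,\dot q)+\mathcal{R}_\varepsilon^*\big(q,-\mathrm{D}\mathcal{E}_\varepsilon(q)-\mathrm{D}\mathcal{F}(q)\big)\Big]\mathrm{d}t .$$ For $\Gamma$-convergence in $C([0,T];\mathbf{Q})$ these functionals, and their limits, are understood as $+\infty$ on curves that are not absolutely continuous. Basic assumptions. A family $(\mathbf{Q},\mathcal{E}_\varepsilon,\mathcal{R}_\varepsilon)$ satisfies the basic assumptions if: (1) $\mathcal{E}_\varepsilon$ $\Gamma$-converges to $\mathcal{E}_0$ in $\mathbf{Q}$. (2) For all $T>0$ there is a functional $\mathfrak{D}_0^T:\mathrm{AC}([0,T];\mathbf{Q})\times C^1(\mathbf{Q};\mathbb{R})\to[0,\infty]$ such that, for each $\mathcal{F}\in C^1(\mathbf{Q};\mathbb{R})$, $\mathfrak{D}_\varepsilon^T(\cdot,\mathcal{F})$ $\Gamma$-converges to $\mathfrak{D}_0^T(\cdot,\mathcal{F})$ in the topology of $C([0,T];\mathbf{Q})$. (3) There is a function $\mathcal{N}_0:T\mathbf{Q}\oplus T^*\mathbf{Q}\to[0,\infty]$, independent of $T$, such that $\mathfrak{D}_0^T(q,\mathcal{F})=\int_0^T\mathcal{N}_0(q(t),\dot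 q(t),-\mathrm{D}\mathcal{F}(q(t)))\,\mathrm{d}t$ for all $\mathcal{F}\in C^1(\mathbf{Q};\mathbb{R})$; and for all $(q,\eta)\in T^*\mathbf{Q}$ the map $v\mapsto\mathcal{N}_0(q,v,\eta)$ is convex and lower semicontinuous. Define $\mathcal{M}_0(q,v,\xi)=\mathcal{N}_0(q,v,\xi+\mathrm{D}\mathcal{E}_0(q))$. (4) $\mathcal{M}_0(q,v,\xi)\ge\langle\xi,v\rangle$ for all $(q,v,\xi)\in T\mathbf{Q}\oplus T^*\mathbf{Q}$. (5) $\mathcal{M}_0(q,v,\xi)\ge\mathcal{M}_0(q,0,\xi)$ for all $(q,v,\xi)\in T\mathbf{Q}\oplus T^*\mathbf{Q}$. EDP convergence with tilting (tilt-EDP convergence) to $(\mathbf{Q},\mathcal{E}_0,\mathcal{R}_0)$ means: the family satisfies the basic assumptions and, for all $q\in\mathbf{Q}$, $\mathcal{M}_0(q,v,\xi)=\mathcal{R}_0(q,v)+\mathcal{R}_0^*(q,\xi)$ for all $v,\xi$, where $\mathcal{R}_0$ is a dissipation potential. Contact EDP convergence with tilting (contact-EDP convergence) to $(\mathbf{Q},\mathcal{E}_0,\mathcal{R}_0)$ means: the family satisfies the basic assumptions and, for all $q\in\mathbf{Q}$, $\{(v,\xi):\mathcal{M}_0(q,v,\xi)=\langle\xi,v\rangle\}=\mathrm{graph}(\partial_v\mathcal{R}_0(q,\cdot))$, where $\mathcal{R}_0$ is a dissipation potential and $\partial_v$ is the convex subdifferential in $v$. *)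

theory Defs
  imports "HOL-Analysis.Analysis" "HOL-Library.Function_Algebras"
begin

section \<open>Smooth manifolds\<close>

text \<open>
  For an open set \<open>S\<close> of a finite-dimensional space, \<open>Ck_on k S f\<close> says that \<open>f\<close> is of class
  \<open>C\<^sup>k\<close> on \<open>S\<close>: it is differentiable and all its directional derivatives are of class
  \<open>C\<^sup>k\<^sup>-\<^sup>1\<close>. (Recursion through directional derivatives keeps the codomain type fixed.)
\<close>

fun Ck_on :: "nat \<Rightarrow> 'a::real_normed_vector set \<Rightarrow> ('a \<Rightarrow> 'b::real_normed_vector) \<Rightarrow> bool" where
  "Ck_on 0 S f = continuous_on S f"
| "Ck_on (Suc k) S f =
    ((\<forall>x\<in>S. f differentiable (at x)) \<and>
     (\<forall>h. Ck_on k S (\<lambda>x. frechet_derivative f (at x) h)))"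

definition smooth_on :: "'a::real_normed_vector set \<Rightarrow> ('a \<Rightarrow> 'b::real_normed_vector) \<Rightarrow> bool" where
  "smooth_on S f \<longleftrightarrow> (\<forall>k. Ck_on k S f)"

text \<open>
  The manifold \<open>\<^bold>Q\<close> is the whole type \<open>'q\<close>. A chart is a pair of its domain and its coordinate
  map (whose values off the domain are irrelevant); the model space \<open>'e\<close> is a finite-dimensional
  real normed space. We do not use \<open>euclidean_space\<close> for \<open>'e\<close>, since that class excludes
  dimension zero.
\<close>

type_synonym ('q, 'e) chart = "'q set \<times> ('q \<Rightarrow> 'e)"

abbreviation dom_chart :: "('q, 'e) chart \<Rightarrow> 'q set" where
  "dom_chart c \<equiv> fst c"

abbreviation coords :: "('q, 'e) chart \<Rightarrow> 'q \<Rightarrow> 'e" where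
  "coords c \<equiv> snd c"

definition inv_chart :: "('q, 'e) chart \<Rightarrow> 'e \<Rightarrow> 'q" where
  "inv_chart c = inv_into (dom_chart c) (coords c)"

definition charts_at :: "('q, 'e) chart set \<Rightarrow> 'q \<Rightarrow> ('q, 'e) chart set" where
  "charts_at A q = {c \<in> A. q \<in> dom_chart c}"

definition smooth_manifold ::
    "('q::{t2_space, second_countable_topology}, 'e::real_normed_vector) chart set \<Rightarrow> bool" where
  "smooth_manifold A \<longleftrightarrow>
     (\<exists>B::'e set. finite B \<and> span B = UNIV) \<and>
     (\<Union>c\<in>A. dom_chart c) = UNIV \<and>
     (\<forall>c\<in>A. open (dom_chart c) \<and> open (coords c ` dom_chart c) \<and>
        homeomorphism (dom_chart c) (coords c ` dom_chart c) (coords c) (inv_chart c)) \<and>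
     (\<forall>c\<in>A. \<forall>d\<in>A. smooth_on (coords c ` (dom_chart c \<inter> dom_chart d)) (coords d \<circ> inv_chart c))"

section \<open>Tangent and cotangent vectors\<close>

text \<open>
  A tangent vector at \<open>q\<close> is the family of its coordinate representations in the charts around
  \<open>q\<close>, related by the Jacobians of the chart transitions. Outside the charts around \<open>q\<close> the family
  is \<open>0\<close>, so that addition is pointwise. With respect to the product topology on the function
  type, evaluation at any chart around \<open>q\<close> is a linear homeomorphism of the tangent space onto
  the model space; so this topology is the usual one on the tangent space.
\<close>

type_synonym ('q, 'e) tvec = "('q, 'e) chart \<Rightarrow> 'e"

definition tangent_space ::
    "('q, 'e::real_normed_vector) chart set \<Rightarrow> 'q \<Rightarrow> ('q, 'e) tvec set" where
  "tangent_space A q =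
     {v. (\<forall>c. c \<notin> charts_at A q \<longrightarrow> v c = 0) \<and>
         (\<forall>c\<in>charts_at A q. \<forall>d\<in>charts_at A q.
            v d = frechet_derivative (coords d \<circ> inv_chart c) (at (coords c q)) (v c))}"

definition tscale :: "real \<Rightarrow> ('q, 'e::real_normed_vector) tvec \<Rightarrow> ('q, 'e) tvec" where
  "tscale a v = (\<lambda>c. a *\<^sub>R v c)"

text \<open>
  A cotangent vector is a linear functional on the tangent space, extended by \<open>0\<close> to all of the
  type \<open>tvec\<close>, so that addition and negation are again pointwise.
\<close>

type_synonym ('q, 'e) ctvec = "('q, 'e) tvec \<Rightarrow> real"

definition cotangent_space ::
    "('q, 'e::real_normed_vector) chart set \<Rightarrow> 'q \<Rightarrow> ('q, 'e) ctvec set" where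
  "cotangent_space A q =
     {\<xi>. (\<forall>v. v \<notin> tangent_space A q \<longrightarrow> \<xi> v = 0) \<and>
         (\<forall>v\<in>tangent_space A q. \<forall>w\<in>tangent_space A q. \<xi> (v + w) = \<xi> v + \<xi> w) \<and>
         (\<forall>v\<in>tangent_space A q. \<forall>a. \<xi> (tscale a v) = a * \<xi> v)}"

definition C1_functions :: "('q, 'e::real_normed_vector) chart set \<Rightarrow> ('q \<Rightarrow> real) set" where
  "C1_functions A = {F. \<forall>c\<in>A. Ck_on 1 (coords c ` dom_chart c) (F \<circ> inv_chart c)}"

text \<open>The value of the differential does not depend on the chart selected.\<close>

definition differential ::
    "('q, 'e::real_normed_vector) chart set \<Rightarrow> ('q \<Rightarrow> real) \<Rightarrow> 'q \<Rightarrow> ('q, 'e) ctvec" where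
  "differential A F q =
     (\<lambda>v. if v \<in> tangent_space A q
          then let c = (SOME c. c \<in> charts_at A q)
               in frechet_derivative (F \<circ> inv_chart c) (at (coords c q)) (v c)
          else 0)"

section \<open>Riemannian metrics\<close>

text \<open>\<open>tvec_of A c q x\<close> is the tangent vector at \<open>q\<close> with coordinates \<open>x\<close> in the chart \<open>c\<close>.\<close>

definition tvec_of ::
    "('q, 'e::real_normed_vector) chart set \<Rightarrow> ('q, 'e) chart \<Rightarrow> 'q \<Rightarrow> 'e \<Rightarrow> ('q, 'e) tvec" where
  "tvec_of A c q x =
     (\<lambda>d. if d \<in> charts_at A q
          then frechet_derivative (coords d \<circ> inv_chart c) (at (coords c q)) x else 0)"

definition riemannian_manifold ::
    "('q::{t2_space, second_countable_topology}, 'e::real_normed_vector) chart set \<Rightarrow>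
     ('q \<Rightarrow> ('q, 'e) tvec \<Rightarrow> ('q, 'e) tvec \<Rightarrow> real) \<Rightarrow> bool" where
  "riemannian_manifold A g \<longleftrightarrow>
     smooth_manifold A \<and>
     (\<forall>q. \<forall>u\<in>tangent_space A q. \<forall>v\<in>tangent_space A q.
        g q u v = g q v u \<and>
        (\<forall>w\<in>tangent_space A q. g q (u + v) w = g q u w + g q v w) \<and>
        (\<forall>a. g q (tscale a u) v = a * g q u v) \<and>
        (u \<noteq> 0 \<longrightarrow> 0 < g q u u)) \<and>
     (\<forall>c\<in>A. \<forall>x y. smooth_on (coords c ` dom_chart c)
        (\<lambda>p. let q = inv_chart c p in g q (tvec_of A c q x) (tvec_of A c q y)))"

section \<open>Gradient systems\<close>

definition convex_fun_on ::
    "('q, 'e::real_normed_vector) tvec set \<Rightarrow> (('q, 'e) tvec \<Rightarrow> ennreal) \<Rightarrow> bool" where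
  "convex_fun_on S f \<longleftrightarrow>
     (\<forall>v\<in>S. \<forall>w\<in>S. \<forall>s\<in>{0..1}.
        f (tscale (1 - s) v + tscale s w) \<le> ennreal (1 - s) * f v + ennreal s * f w)"

definition lsc_on :: "'a::topological_space set \<Rightarrow> ('a \<Rightarrow> 'b::linorder) \<Rightarrow> bool" where
  "lsc_on S f \<longleftrightarrow> (\<forall>x\<in>S. \<forall>a. a < f x \<longrightarrow> (\<forall>\<^sub>F y in at x within S. a < f y))"

definition dissipation_potential ::
    "('q, 'e::real_normed_vector) chart set \<Rightarrow> ('q \<Rightarrow> ('q, 'e) tvec \<Rightarrow> ennreal) \<Rightarrow> bool" where
  "dissipation_potential A R \<longleftrightarrow>
     (\<forall>q. convex_fun_on (tangent_space A q) (R q) \<and> lsc_on (tangent_space A q) (R q) \<and> R q 0 = 0)"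

text \<open>
  The supremum is nonnegative when \<open>R q 0 = 0\<close> (take \<open>v = 0\<close>), so \<open>e2ennreal\<close> loses nothing.
\<close>

definition dual_potential ::
    "('q, 'e::real_normed_vector) chart set \<Rightarrow> ('q \<Rightarrow> ('q, 'e) tvec \<Rightarrow> ennreal) \<Rightarrow>
     'q \<Rightarrow> ('q, 'e) ctvec \<Rightarrow> ennreal" where
  "dual_potential A R q \<xi> =
     e2ennreal (SUP v\<in>tangent_space A q. ereal (\<xi> v) - enn2ereal (R q v))"

definition subdifferential ::
    "('q, 'e::real_normed_vector) chart set \<Rightarrow> ('q \<Rightarrow> ('q, 'e) tvec \<Rightarrow> ennreal) \<Rightarrow>
     'q \<Rightarrow> ('q, 'e) tvec \<Rightarrow> ('q, 'e) ctvec set" where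
  "subdifferential A R q v =
     {\<xi> \<in> cotangent_space A q.
        \<forall>w\<in>tangent_space A q. enn2ereal (R q w) \<ge> enn2ereal (R q v) + ereal (\<xi> (w - v))}"

definition gradient_system ::
    "('q::{t2_space, second_countable_topology}, 'e::real_normed_vector) chart set \<Rightarrow>
     ('q \<Rightarrow> ('q, 'e) tvec \<Rightarrow> ('q, 'e) tvec \<Rightarrow> real) \<Rightarrow>
     ('q \<Rightarrow> real) \<Rightarrow> ('q \<Rightarrow> ('q, 'e) tvec \<Rightarrow> ennreal) \<Rightarrow> bool" where
  "gradient_system A g E R \<longleftrightarrow>
     riemannian_manifold A g \<and> E \<in> C1_functions A \<and> dissipation_potential A R"

section \<open>Curves\<close>

text \<open>Curves on \<open>[0,T]\<close> take the value \<open>undefined\<close> outside \<open>[0,T]\<close>.\<close>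

definition C_curves :: "real \<Rightarrow> (real \<Rightarrow> 'q::topological_space) set" where
  "C_curves T = {q \<in> extensional {0..T}. continuous_on {0..T} q}"

text \<open>
  The topology of \<open>C([0,T];\<^bold>Q)\<close>: the compact-open topology, which is the topology of uniform
  convergence for any metric inducing the topology of \<open>\<^bold>Q\<close>.
\<close>

definition C_topology :: "real \<Rightarrow> (real \<Rightarrow> 'q::topological_space) topology" where
  "C_topology T =
     topology_generated_by
       {{q \<in> C_curves T. q ` K \<subseteq> U} | K U. compact K \<and> K \<subseteq> {0..T} \<and> open U}"

definition absolutely_continuous_on :: "real \<Rightarrow> real \<Rightarrow> (real \<Rightarrow> 'e::metric_space) \<Rightarrow> bool" where
  "absolutely_continuous_on a b f \<longleftrightarrow>
     (\<forall>e>0. \<exists>d>0. \<forall>I. finite I \<and>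
        (\<forall>(s, t)\<in>I. a \<le> s \<and> s \<le> t \<and> t \<le> b) \<and>
        pairwise (\<lambda>(s, t) (s', t'). {s<..<t} \<inter> {s'<..<t'} = {}) I \<and>
        (\<Sum>(s, t)\<in>I. t - s) < d \<longrightarrow>
        (\<Sum>(s, t)\<in>I. dist (f s) (f t)) < e)"

definition AC_curves ::
    "('q::topological_space, 'e::real_normed_vector) chart set \<Rightarrow> real \<Rightarrow> (real \<Rightarrow> 'q) set" where
  "AC_curves A T =
     {q \<in> C_curves T. \<forall>c\<in>A. \<forall>a b. 0 \<le> a \<and> a \<le> b \<and> b \<le> T \<and> q ` {a..b} \<subseteq> dom_chart c \<longrightarrow>
        absolutely_continuous_on a b (coords c \<circ> q)}"

text \<open>
  For an absolutely continuous curve on \<open>[0,T]\<close> this is its derivative at almost every \<open>t\<close> in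
  \<open>[0,T]\<close>; on the remaining null set the value is arbitrary.
\<close>

definition velocity ::
    "('q, 'e::real_normed_vector) chart set \<Rightarrow> (real \<Rightarrow> 'q) \<Rightarrow> real \<Rightarrow> ('q, 'e) tvec" where
  "velocity A q t =
     (\<lambda>c. if c \<in> charts_at A (q t) then vector_derivative (coords c \<circ> q) (at t) else 0)"

section \<open>Convergence of gradient systems\<close>

text \<open>
  \<open>\<Gamma>\<close>-convergence for \<open>\<epsilon> \<rightarrow> 0\<^sup>+\<close>, by the liminf inequality and recovery families. All spaces
  used here are first countable.
\<close>

definition Gamma_converges ::
    "'x topology \<Rightarrow> (real \<Rightarrow> 'x \<Rightarrow> 'v::complete_linorder) \<Rightarrow> ('x \<Rightarrow> 'v) \<Rightarrow> bool" where
  "Gamma_converges X F F0 \<longleftrightarrow>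
     (\<forall>x\<in>topspace X.
        (\<forall>y. limitin X y x (at_right 0) \<longrightarrow> F0 x \<le> Liminf (at_right 0) (\<lambda>\<epsilon>. F \<epsilon> (y \<epsilon>))) \<and>
        (\<exists>y. limitin X y x (at_right 0) \<and> Limsup (at_right 0) (\<lambda>\<epsilon>. F \<epsilon> (y \<epsilon>)) \<le> F0 x))"

definition extend_by_infinity ::
    "('q::topological_space, 'e::real_normed_vector) chart set \<Rightarrow> real \<Rightarrow>
     ((real \<Rightarrow> 'q) \<Rightarrow> ennreal) \<Rightarrow> (real \<Rightarrow> 'q) \<Rightarrow> ennreal" where
  "extend_by_infinity A T D q = (if q \<in> AC_curves A T then D q else \<infinity>)"

definition dissipation_functional ::
    "('q::topological_space, 'e::real_normed_vector) chart set \<Rightarrow> ('q \<Rightarrow> real) \<Rightarrow>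
     ('q \<Rightarrow> ('q, 'e) tvec \<Rightarrow> ennreal) \<Rightarrow> real \<Rightarrow> (real \<Rightarrow> 'q) \<Rightarrow> ('q \<Rightarrow> real) \<Rightarrow> ennreal" where
  "dissipation_functional A E R T q F =
     (\<integral>\<^sup>+ t. R (q t) (velocity A q t) +
        dual_potential A R (q t) (- differential A E (q t) - differential A F (q t))
      \<partial>lebesgue_on {0..T})"

definition M0_of ::
    "('q, 'e::real_normed_vector) chart set \<Rightarrow> ('q \<Rightarrow> real) \<Rightarrow>
     ('q \<Rightarrow> ('q, 'e) tvec \<Rightarrow> ('q, 'e) ctvec \<Rightarrow> ennreal) \<Rightarrow>
     'q \<Rightarrow> ('q, 'e) tvec \<Rightarrow> ('q, 'e) ctvec \<Rightarrow> ennreal" where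
  "M0_of A E0 N0 q v \<xi> = N0 q v (\<xi> + differential A E0 q)"

text \<open>
  The integrand \<open>N0\<close> is a parameter, since the two notions of convergence below impose further
  conditions on the same \<open>N0\<close> that represents the limit functionals. Only its values at
  \<open>(q, v, \<eta>)\<close> with \<open>v\<close> tangent and \<open>\<eta>\<close> cotangent at \<open>q\<close> matter.
\<close>

definition basic_assumptions ::
    "('q::{t2_space, second_countable_topology}, 'e::real_normed_vector) chart set \<Rightarrow>
     ('q \<Rightarrow> ('q, 'e) tvec \<Rightarrow> ('q, 'e) tvec \<Rightarrow> real) \<Rightarrow>
     (real \<Rightarrow> 'q \<Rightarrow> real) \<Rightarrow> (real \<Rightarrow> 'q \<Rightarrow> ('q, 'e) tvec \<Rightarrow> ennreal) \<Rightarrow> ('q \<Rightarrow> real) \<Rightarrow>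
     ('q \<Rightarrow> ('q, 'e) tvec \<Rightarrow> ('q, 'e) ctvec \<Rightarrow> ennreal) \<Rightarrow> bool" where
  "basic_assumptions A g E R E0 N0 \<longleftrightarrow>
     (\<forall>\<epsilon>>0. gradient_system A g (E \<epsilon>) (R \<epsilon>)) \<and>
     Gamma_converges euclidean (\<lambda>\<epsilon> q. ereal (E \<epsilon> q)) (\<lambda>q. ereal (E0 q)) \<and>
     (\<exists>D0 :: real \<Rightarrow> (real \<Rightarrow> 'q) \<Rightarrow> ('q \<Rightarrow> real) \<Rightarrow> ennreal.
        (\<forall>T>0. \<forall>F\<in>C1_functions A.
           Gamma_converges (C_topology T)
             (\<lambda>\<epsilon>. extend_by_infinity A T (\<lambda>q. dissipation_functional A (E \<epsilon>) (R \<epsilon>) T q F))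
             (extend_by_infinity A T (\<lambda>q. D0 T q F))) \<and>
        (\<forall>T>0. \<forall>F\<in>C1_functions A. \<forall>q\<in>AC_curves A T.
           D0 T q F =
             (\<integral>\<^sup>+ t. N0 (q t) (velocity A q t) (- differential A F (q t)) \<partial>lebesgue_on {0..T}))) \<and>
     (\<forall>q. \<forall>\<eta>\<in>cotangent_space A q.
        convex_fun_on (tangent_space A q) (\<lambda>v. N0 q v \<eta>) \<and>
        lsc_on (tangent_space A q) (\<lambda>v. N0 q v \<eta>)) \<and>
     (\<forall>q. \<forall>v\<in>tangent_space A q. \<forall>\<xi>\<in>cotangent_space A q.
        enn2ereal (M0_of A E0 N0 q v \<xi>) \<ge> ereal (\<xi> v)) \<and>
     (\<forall>q. \<forall>v\<in>tangent_space A q. \<forall>\<xi>\<in>cotangent_space A q.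
        M0_of A E0 N0 q v \<xi> \<ge> M0_of A E0 N0 q 0 \<xi>)"

definition tilt_EDP_converges ::
    "('q::{t2_space, second_countable_topology}, 'e::real_normed_vector) chart set \<Rightarrow>
     ('q \<Rightarrow> ('q, 'e) tvec \<Rightarrow> ('q, 'e) tvec \<Rightarrow> real) \<Rightarrow>
     (real \<Rightarrow> 'q \<Rightarrow> real) \<Rightarrow> (real \<Rightarrow> 'q \<Rightarrow> ('q, 'e) tvec \<Rightarrow> ennreal) \<Rightarrow>
     ('q \<Rightarrow> real) \<Rightarrow> ('q \<Rightarrow> ('q, 'e) tvec \<Rightarrow> ennreal) \<Rightarrow> bool" where
  "tilt_EDP_converges A g E R E0 R0 \<longleftrightarrow>
     gradient_system A g E0 R0 \<and>
     (\<exists>N0. basic_assumptions A g E R E0 N0 \<and>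
        (\<forall>q. \<forall>v\<in>tangent_space A q. \<forall>\<xi>\<in>cotangent_space A q.
           M0_of A E0 N0 q v \<xi> = R0 q v + dual_potential A R0 q \<xi>))"

definition contact_EDP_converges ::
    "('q::{t2_space, second_countable_topology}, 'e::real_normed_vector) chart set \<Rightarrow>
     ('q \<Rightarrow> ('q, 'e) tvec \<Rightarrow> ('q, 'e) tvec \<Rightarrow> real) \<Rightarrow>
     (real \<Rightarrow> 'q \<Rightarrow> real) \<Rightarrow> (real \<Rightarrow> 'q \<Rightarrow> ('q, 'e) tvec \<Rightarrow> ennreal) \<Rightarrow>
     ('q \<Rightarrow> real) \<Rightarrow> ('q \<Rightarrow> ('q, 'e) tvec \<Rightarrow> ennreal) \<Rightarrow> bool" where
  "contact_EDP_converges A g E R E0 R0 \<longleftrightarrow>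
     gradient_system A g E0 R0 \<and>
     (\<exists>N0. basic_assumptions A g E R E0 N0 \<and>
        (\<forall>q. {(v, \<xi>). v \<in> tangent_space A q \<and> \<xi> \<in> cotangent_space A q \<and>
                 enn2ereal (M0_of A E0 N0 q v \<xi>) = ereal (\<xi> v)} =
             {(v, \<xi>). v \<in> tangent_space A q \<and> \<xi> \<in> subdifferential A R0 q v}))"

end

theory Submission
  imports Defs
begin

text \<open>
  Tilting the energies by a \<open>C\<^sup>1\<close> function \<open>F\<close> is invisible in the integrand \<open>M0\<close>. Since the
  differential is additive on \<open>C\<^sup>1\<close> functions (\<open>differential_add\<close>), the dissipation functional
  of \<open>E\<^sub>\<epsilon> + F\<close> with the tilt \<open>G\<close> is that of \<open>E\<^sub>\<epsilon>\<close> with the tilt \<open>F + G\<close>. Hence its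
  \<open>\<Gamma>\<close>-limit is the given limit functional at the tilt \<open>F + G\<close>, and this is represented by the
  shifted integrand \<open>(q, v, \<eta>) \<mapsto> N0 q v (\<eta> - DF(q))\<close>.
  Shifting the cotangent argument back by \<open>D(E\<^sub>0 + F)\<close> instead of \<open>DE\<^sub>0\<close> cancels \<open>DF\<close>, so \<open>M0\<close>
  is the same for the tilted and the original family (\<open>M0_of_tilted\<close>). All conditions on \<open>M0\<close>,
  in particular those that single out \<open>R0\<close>, therefore carry over verbatim. Convexity and lower
  semicontinuity in \<open>v\<close> carry over because \<open>\<eta> - DF(q)\<close> is again a cotangent vector, and the
  energies \<open>\<Gamma>\<close>-converge because \<open>F\<close> is a continuous perturbation
  (\<open>Gamma_converges_add_continuous\<close>).
\<close>

section \<open>Stability of Gamma-convergence\<close>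

text \<open>
  The bound \<open>a\<close> and the limit \<open>b\<close> are real, so no undefined sum of infinities can occur; neither
  this lemma nor its dual needs sign conditions on the summands.
\<close>

lemma Liminf_ereal_add_ge:
  fixes u v :: "'i \<Rightarrow> real"
  assumes u: "ereal a \<le> Liminf F (\<lambda>i. ereal (u i))" and v: "(v \<longlongrightarrow> b) F"
  shows "ereal (a + b) \<le> Liminf F (\<lambda>i. ereal (u i + v i))"
  unfolding le_Liminf_iff
proof (intro allI impI)
  fix y assume y: "y < ereal (a + b)"
  show "\<forall>\<^sub>F i in F. y < ereal (u i + v i)"
  proof (cases y)
    case (real r)
    define e where "e = (a + b - r) / 2"
    have e: "0 < e" "r = (a - e) + (b - e)"
      using y real by (auto simp: e_def field_simps)
    have "\<forall>\<^sub>F i in F. ereal (a - e) < ereal (u i)"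
      using u e(1) unfolding le_Liminf_iff
      by (metis diff_less_eq less_add_same_cancel1 less_ereal.simps(1))
    moreover have "\<forall>\<^sub>F i in F. b - e < v i"
      using v e(1) by (intro order_tendstoD) auto
    ultimately show ?thesis
      by eventually_elim (use real e(2) in simp)
  qed (use y in auto)
qed

lemma Limsup_ereal_add_le:
  fixes u v :: "'i \<Rightarrow> real"
  assumes u: "Limsup F (\<lambda>i. ereal (u i)) \<le> ereal a" and v: "(v \<longlongrightarrow> b) F"
  shows "Limsup F (\<lambda>i. ereal (u i + v i)) \<le> ereal (a + b)"
proof -
  have "ereal (- a) \<le> Liminf F (\<lambda>i. ereal (- u i))"
    using u ereal_Liminf_uminus[of F "\<lambda>i. ereal (u i)"] ereal_minus_le_minus by fastforce
  from Liminf_ereal_add_ge[OF this tendsto_minus[OF v]]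
  have "- ereal (a + b) \<le> Liminf F (\<lambda>i. - ereal (u i + v i))"
    by (simp add: algebra_simps)
  then show ?thesis
    by (simp only: ereal_Liminf_uminus ereal_minus_le_minus)
qed

text \<open>
  Along a convergent family the perturbation converges, so the liminf inequality survives, and
  a recovery family for the unperturbed functionals is one for the perturbed functionals.
\<close>

lemma Gamma_converges_add_continuous:
  assumes \<Gamma>: "Gamma_converges X (\<lambda>\<epsilon> x. ereal (E \<epsilon> x)) (\<lambda>x. ereal (E0 x))"
    and f: "continuous_map X euclideanreal f"
  shows "Gamma_converges X (\<lambda>\<epsilon> x. ereal (E \<epsilon> x + f x)) (\<lambda>x. ereal (E0 x + f x))"
  unfolding Gamma_converges_def
proof (intro ballI conjI allI impI)
  have lim: "((\<lambda>\<epsilon>. f (y \<epsilon>)) \<longlongrightarrow> f x) (at_right 0)" if "limitin X y x (at_right (0::real))" for x y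
    using continuous_map_limit[OF f that] by (simp add: o_def)
  fix x assume x: "x \<in> topspace X"
  show "ereal (E0 x + f x) \<le> Liminf (at_right 0) (\<lambda>\<epsilon>. ereal (E \<epsilon> (y \<epsilon>) + f (y \<epsilon>)))"
    if y: "limitin X y x (at_right 0)" for y
  proof (rule Liminf_ereal_add_ge[OF _ lim[OF y]])
    show "ereal (E0 x) \<le> Liminf (at_right 0) (\<lambda>\<epsilon>. ereal (E \<epsilon> (y \<epsilon>)))"
      using \<Gamma> x y by (simp add: Gamma_converges_def)
  qed
  obtain y where y: "limitin X y x (at_right 0)"
    and le: "Limsup (at_right 0) (\<lambda>\<epsilon>. ereal (E \<epsilon> (y \<epsilon>))) \<le> ereal (E0 x)"
    using \<Gamma> x unfolding Gamma_converges_def by meson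
  show "\<exists>y. limitin X y x (at_right 0) \<and>
      Limsup (at_right 0) (\<lambda>\<epsilon>. ereal (E \<epsilon> (y \<epsilon>) + f (y \<epsilon>))) \<le> ereal (E0 x + f x)"
    using y Limsup_ereal_add_le[OF le lim[OF y]] by (intro exI[of _ y] conjI)
qed

lemma Gamma_converges_transform:
  assumes F: "Gamma_converges X F F0" and eq: "\<And>\<epsilon>. 0 < \<epsilon> \<Longrightarrow> G \<epsilon> = F \<epsilon>"
  shows "Gamma_converges X G F0"
proof -
  have ev: "\<forall>\<^sub>F \<epsilon> in at_right 0. G \<epsilon> (y \<epsilon>) = F \<epsilon> (y \<epsilon>)" for y
    using eventually_at_right_less[of "0::real"] by eventually_elim (simp add: eq)
  show ?thesis
    using F unfolding Gamma_converges_def by (simp add: Liminf_eq[OF ev] Limsup_eq[OF ev])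
qed

section \<open>Calculus on the manifold\<close>

lemma frechet_derivative_add:
  assumes "f differentiable at x" and "g differentiable at x"
  shows "frechet_derivative (f + g) (at x) h =
    frechet_derivative f (at x) h + frechet_derivative g (at x) h"
proof -
  have "((\<lambda>y. f y + g y) has_derivative
      (\<lambda>h. frechet_derivative f (at x) h + frechet_derivative g (at x) h)) (at x)"
    using assms by (intro has_derivative_add) (auto simp: frechet_derivative_works[symmetric])
  from fun_cong[OF frechet_derivative_at[OF this], of h] show ?thesis
    unfolding plus_fun_def by (rule sym)
qed

lemma C1_functions_iff:
  "F \<in> C1_functions A \<longleftrightarrow> (\<forall>c\<in>A. \<forall>x\<in>coords c ` dom_chart c. (F \<circ> inv_chart c) differentiable at x) \<and>
    (\<forall>c\<in>A. \<forall>h. continuous_on (coords c ` dom_chart c)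
      (\<lambda>x. frechet_derivative (F \<circ> inv_chart c) (at x) h))"
  by (auto simp: C1_functions_def)

lemma C1_differentiable:
  assumes "F \<in> C1_functions A" and "c \<in> charts_at A q"
  shows "(F \<circ> inv_chart c) differentiable at (coords c q)"
  using assms by (auto simp: C1_functions_iff charts_at_def)

lemma C1_functions_add:
  assumes F: "F \<in> C1_functions A" and G: "G \<in> C1_functions A"
  shows "F + G \<in> C1_functions A"
  unfolding C1_functions_iff
proof (intro conjI ballI allI)
  have comp: "(F + G) \<circ> inv_chart c = (F \<circ> inv_chart c) + (G \<circ> inv_chart c)" for c
    by auto
  fix c assume c: "c \<in> A"
  have diff: "(F \<circ> inv_chart c) differentiable at x" "(G \<circ> inv_chart c) differentiable at x"
    if "x \<in> coords c ` dom_chart c" for x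
    using F G c that by (auto simp: C1_functions_iff)
  show "((F + G) \<circ> inv_chart c) differentiable at x" if "x \<in> coords c ` dom_chart c" for x
    using differentiable_add[OF diff[OF that]] unfolding comp plus_fun_def[of "_ \<circ> _"] .
  show "continuous_on (coords c ` dom_chart c)
      (\<lambda>x. frechet_derivative ((F + G) \<circ> inv_chart c) (at x) h)" for h
  proof (rule continuous_on_eq)
    show "continuous_on (coords c ` dom_chart c)
        (\<lambda>x. frechet_derivative (F \<circ> inv_chart c) (at x) h
          + frechet_derivative (G \<circ> inv_chart c) (at x) h)"
      using F G c by (intro continuous_on_add) (auto simp: C1_functions_iff)
  qed (simp add: comp frechet_derivative_add diff)
qed

lemma charts_at_nonempty:
  assumes "smooth_manifold A"
  obtains c where "c \<in> charts_at A q"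
proof -
  have "q \<in> (\<Union>c\<in>A. dom_chart c)"
    using assms by (simp add: smooth_manifold_def)
  then show thesis
    using that by (auto simp: charts_at_def)
qed

lemma C1_functions_continuous:
  assumes A: "smooth_manifold A" and F: "F \<in> C1_functions A"
  shows "continuous_on UNIV F"
proof -
  have "continuous_on (dom_chart c) F" if c: "c \<in> A" for c
  proof -
    have hom: "homeomorphism (dom_chart c) (coords c ` dom_chart c) (coords c) (inv_chart c)"
      using A c by (simp add: smooth_manifold_def)
    have "continuous_on (coords c ` dom_chart c) (F \<circ> inv_chart c)"
    proof (rule differentiable_imp_continuous_on)
      show "(F \<circ> inv_chart c) differentiable_on coords c ` dom_chart c"
        using F c unfolding C1_functions_iff differentiable_on_def
        by (blast intro: differentiable_at_withinI)
    qed
    then have "continuous_on (dom_chart c) ((F \<circ> inv_chart c) \<circ> coords c)"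
      by (rule continuous_on_compose[OF homeomorphism_cont1[OF hom]])
    then show ?thesis
      by (rule continuous_on_eq) (simp add: homeomorphism_apply1[OF hom])
  qed
  then have "continuous_on (\<Union>c\<in>A. dom_chart c) F"
    using A by (intro continuous_on_open_UN) (auto simp: smooth_manifold_def)
  then show ?thesis
    using A by (simp add: smooth_manifold_def)
qed

text \<open>
  Tangent spaces are closed under the vector space operations because the Jacobians that relate
  the coordinate representations are linear.
\<close>

lemma transition_linear:
  assumes A: "smooth_manifold A" and c: "c \<in> charts_at A q" and d: "d \<in> charts_at A q"
  shows "linear (frechet_derivative (coords d \<circ> inv_chart c) (at (coords c q)))"
proof -
  have "Ck_on (Suc 0) (coords c ` (dom_chart c \<inter> dom_chart d)) (coords d \<circ> inv_chart c)"
    using A c d by (simp add: smooth_manifold_def smooth_on_def charts_at_def del: Ck_on.simps)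
  then have "(coords d \<circ> inv_chart c) differentiable at (coords c q)"
    using c d by (auto simp: charts_at_def)
  then show ?thesis
    by (rule linear_frechet_derivative)
qed

lemma tangent_space_outside:
  assumes "v \<in> tangent_space A q" and "c \<notin> charts_at A q"
  shows "v c = 0"
  using assms unfolding tangent_space_def by blast

lemma tangent_space_transition:
  assumes "v \<in> tangent_space A q" and "c \<in> charts_at A q" and "d \<in> charts_at A q"
  shows "v d = frechet_derivative (coords d \<circ> inv_chart c) (at (coords c q)) (v c)"
  using assms unfolding tangent_space_def by blast

lemma tangent_space_add:
  assumes "smooth_manifold A" and "v \<in> tangent_space A q" and "w \<in> tangent_space A q"
  shows "v + w \<in> tangent_space A q"
  unfolding tangent_space_def mem_Collect_eq
proof (intro conjI allI ballI impI)
  show "(v + w) c = 0" if "c \<notin> charts_at A q" for c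
    using tangent_space_outside[OF assms(2) that] tangent_space_outside[OF assms(3) that] by simp
  show "(v + w) d = frechet_derivative (coords d \<circ> inv_chart c) (at (coords c q)) ((v + w) c)"
    if c: "c \<in> charts_at A q" and d: "d \<in> charts_at A q" for c d
    unfolding plus_fun_apply linear_add[OF transition_linear[OF assms(1) c d]]
    using tangent_space_transition[OF assms(2) c d] tangent_space_transition[OF assms(3) c d]
    by (rule arg_cong2)
qed

lemma tangent_space_tscale:
  assumes "smooth_manifold A" and "v \<in> tangent_space A q"
  shows "tscale a v \<in> tangent_space A q"
  unfolding tangent_space_def mem_Collect_eq
proof (intro conjI allI ballI impI)
  show "tscale a v c = 0" if "c \<notin> charts_at A q" for c
    using tangent_space_outside[OF assms(2) that] by (simp add: tscale_def)
  show "tscale a v d =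
      frechet_derivative (coords d \<circ> inv_chart c) (at (coords c q)) (tscale a v c)"
    if c: "c \<in> charts_at A q" and d: "d \<in> charts_at A q" for c d
    unfolding tscale_def linear_scale[OF transition_linear[OF assms(1) c d]]
    using tangent_space_transition[OF assms(2) c d] by (rule arg_cong)
qed

lemma differential_in_cotangent_space:
  assumes A: "smooth_manifold A" and F: "F \<in> C1_functions A"
  shows "differential A F q \<in> cotangent_space A q"
proof -
  define c where "c = (SOME c. c \<in> charts_at A q)"
  have c: "c \<in> charts_at A q"
    unfolding c_def using charts_at_nonempty[OF A] by (metis someI)
  have lin: "linear (frechet_derivative (F \<circ> inv_chart c) (at (coords c q)))"
    by (rule linear_frechet_derivative[OF C1_differentiable[OF F c]])
  show ?thesis
    unfolding cotangent_space_def mem_Collect_eq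
  proof (intro conjI allI ballI impI)
    show "differential A F q v = 0" if "v \<notin> tangent_space A q" for v
      using that by (simp add: differential_def)
    show "differential A F q (v + w) = differential A F q v + differential A F q w"
      if "v \<in> tangent_space A q" "w \<in> tangent_space A q" for v w
      using that tangent_space_add[OF A that]
      by (simp add: differential_def c_def[symmetric] linear_add[OF lin])
    show "differential A F q (tscale a v) = a * differential A F q v"
      if "v \<in> tangent_space A q" for v a
    proof -
      have "tscale a v c = a *\<^sub>R v c"
        by (simp add: tscale_def)
      then show ?thesis
        using that tangent_space_tscale[OF A that]
        by (simp add: differential_def c_def[symmetric] linear_scale[OF lin])
    qed
  qed
qed

lemma cotangent_space_diff:
  assumes "\<xi> \<in> cotangent_space A q" and "\<eta> \<in> cotangent_space A q"
  shows "\<xi> - \<eta> \<in> cotangent_space A q"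
  using assms by (simp add: cotangent_space_def algebra_simps)

lemma differential_add:
  assumes A: "smooth_manifold A" and F: "F \<in> C1_functions A" and G: "G \<in> C1_functions A"
  shows "differential A (F + G) q = differential A F q + differential A G q"
proof -
  define c where "c = (SOME c. c \<in> charts_at A q)"
  have c: "c \<in> charts_at A q"
    unfolding c_def using charts_at_nonempty[OF A] by (metis someI)
  have comp: "(F + G) \<circ> inv_chart c = (F \<circ> inv_chart c) + (G \<circ> inv_chart c)"
    by auto
  show ?thesis
    using frechet_derivative_add[OF C1_differentiable[OF F c] C1_differentiable[OF G c]]
    by (simp add: fun_eq_iff differential_def c_def[symmetric] comp)
qed

section \<open>Tilting\<close>

lemma gradient_system_tilted:
  assumes "gradient_system A g E R" and "F \<in> C1_functions A"
  shows "gradient_system A g (E + F) R"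
  using assms by (simp add: gradient_system_def C1_functions_add)

lemma dissipation_functional_tilted:
  assumes "smooth_manifold A" and "E \<in> C1_functions A" and "F \<in> C1_functions A"
    and "G \<in> C1_functions A"
  shows "dissipation_functional A (E + F) R T q G = dissipation_functional A E R T q (F + G)"
  using assms by (simp add: dissipation_functional_def differential_add algebra_simps)

text \<open>
  The shift of the integrand by \<open>- DF\<close> and the shift by \<open>D(E\<^sub>0 + F)\<close> in the definition of \<open>M0\<close>
  together leave only the shift by \<open>DE\<^sub>0\<close>.
\<close>

lemma M0_of_tilted:
  assumes "smooth_manifold A" and "E0 \<in> C1_functions A" and "F \<in> C1_functions A"
  shows "M0_of A (E0 + F) (\<lambda>q v \<eta>. N0 q v (\<eta> - differential A F q)) = M0_of A E0 N0"
proof (intro ext)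
  fix q v \<xi>
  have "\<xi> + differential A (E0 + F) q - differential A F q = \<xi> + differential A E0 q"
    by (simp add: differential_add[OF assms])
  then show "M0_of A (E0 + F) (\<lambda>q v \<eta>. N0 q v (\<eta> - differential A F q)) q v \<xi> =
      M0_of A E0 N0 q v \<xi>"
    unfolding M0_of_def by (rule arg_cong)
qed

text \<open>
  The limit functional of the tilted family at the tilt \<open>G\<close> is that of the original family at
  the tilt \<open>F + G\<close>.
\<close>

lemma basic_assumptions_tilted:
  assumes basic: "basic_assumptions A g E R E0 N0"
    and E0: "gradient_system A g E0 R0" and F: "F \<in> C1_functions A"
  shows "basic_assumptions A g (\<lambda>\<epsilon>. E \<epsilon> + F) R (E0 + F)
    (\<lambda>q v \<eta>. N0 q v (\<eta> - differential A F q))"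
proof -
  have A: "smooth_manifold A" and E0C1: "E0 \<in> C1_functions A"
    using E0 by (auto simp: gradient_system_def riemannian_manifold_def)
  have grad: "gradient_system A g (E \<epsilon>) (R \<epsilon>)" if "0 < \<epsilon>" for \<epsilon>
    using basic that by (simp add: basic_assumptions_def)
  then have EC1: "E \<epsilon> \<in> C1_functions A" if "0 < \<epsilon>" for \<epsilon>
    using that by (simp add: gradient_system_def)
  obtain D0 :: "real \<Rightarrow> (real \<Rightarrow> 'a) \<Rightarrow> ('a \<Rightarrow> real) \<Rightarrow> ennreal" where
    D0_\<Gamma>: "\<forall>T>0. \<forall>G\<in>C1_functions A. Gamma_converges (C_topology T)
      (\<lambda>\<epsilon>. extend_by_infinity A T (\<lambda>q. dissipation_functional A (E \<epsilon>) (R \<epsilon>) T q G))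
      (extend_by_infinity A T (\<lambda>q. D0 T q G))" and
    D0_int: "\<forall>T>0. \<forall>G\<in>C1_functions A. \<forall>q\<in>AC_curves A T. D0 T q G =
      (\<integral>\<^sup>+ t. N0 (q t) (velocity A q t) (- differential A G (q t)) \<partial>lebesgue_on {0..T})"
    using basic unfolding basic_assumptions_def by (elim conjE exE) (rule that)
  have FG: "F + G \<in> C1_functions A" if "G \<in> C1_functions A" for G
    using F that by (rule C1_functions_add)
  have energies: "Gamma_converges euclidean (\<lambda>\<epsilon> q. ereal ((E \<epsilon> + F) q)) (\<lambda>q. ereal ((E0 + F) q))"
  proof -
    have "Gamma_converges euclidean (\<lambda>\<epsilon> q. ereal (E \<epsilon> q)) (\<lambda>q. ereal (E0 q))"
      using basic unfolding basic_assumptions_def by (elim conjE)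
    moreover have "continuous_map euclidean euclideanreal F"
      using C1_functions_continuous[OF A F] by simp
    ultimately show ?thesis
      unfolding plus_fun_apply by (rule Gamma_converges_add_continuous)
  qed
  have functionals: "Gamma_converges (C_topology T)
      (\<lambda>\<epsilon>. extend_by_infinity A T (\<lambda>q. dissipation_functional A (E \<epsilon> + F) (R \<epsilon>) T q G))
      (extend_by_infinity A T (\<lambda>q. D0 T q (F + G)))"
    if T: "0 < T" and G: "G \<in> C1_functions A" for T G
    using D0_\<Gamma>[rule_format, OF T FG[OF G]]
  proof (rule Gamma_converges_transform)
    fix \<epsilon> :: real assume "0 < \<epsilon>"
    then have "dissipation_functional A (E \<epsilon> + F) (R \<epsilon>) T q G =
        dissipation_functional A (E \<epsilon>) (R \<epsilon>) T q (F + G)" for q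
      by (intro dissipation_functional_tilted A EC1 F G)
    then show "extend_by_infinity A T (\<lambda>q. dissipation_functional A (E \<epsilon> + F) (R \<epsilon>) T q G) =
        extend_by_infinity A T (\<lambda>q. dissipation_functional A (E \<epsilon>) (R \<epsilon>) T q (F + G))"
      by (simp only:)
  qed
  have integral: "D0 T q (F + G) =
      (\<integral>\<^sup>+ t. N0 (q t) (velocity A q t) (- differential A G (q t) - differential A F (q t))
        \<partial>lebesgue_on {0..T})"
    if T: "0 < T" and G: "G \<in> C1_functions A" and q: "q \<in> AC_curves A T" for T G q
  proof -
    have "- differential A (F + G) p = - differential A G p - differential A F p" for p
      by (simp add: differential_add[OF A F G] algebra_simps)
    with D0_int[rule_format, OF T FG[OF G] q] show ?thesis
      by (simp only:)
  qed
  have "\<eta> - differential A F q \<in> cotangent_space A q" if "\<eta> \<in> cotangent_space A q" for q \<eta>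
    using that differential_in_cotangent_space[OF A F] by (rule cotangent_space_diff)
  then have convex_lsc: "convex_fun_on (tangent_space A q) (\<lambda>v. N0 q v (\<eta> - differential A F q)) \<and>
      lsc_on (tangent_space A q) (\<lambda>v. N0 q v (\<eta> - differential A F q))"
    if "\<eta> \<in> cotangent_space A q" for q \<eta>
    using that basic unfolding basic_assumptions_def by (elim conjE) blast
  have gradient: "gradient_system A g (E \<epsilon> + F) (R \<epsilon>)" if "0 < \<epsilon>" for \<epsilon>
    using grad[OF that] F by (rule gradient_system_tilted)
  have M0: "\<forall>q. \<forall>v\<in>tangent_space A q. \<forall>\<xi>\<in>cotangent_space A q.
      ereal (\<xi> v) \<le> enn2ereal (M0_of A E0 N0 q v \<xi>)"
    "\<forall>q. \<forall>v\<in>tangent_space A q. \<forall>\<xi>\<in>cotangent_space A q.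
      M0_of A E0 N0 q 0 \<xi> \<le> M0_of A E0 N0 q v \<xi>"
    using basic unfolding basic_assumptions_def by blast+
  show ?thesis
    unfolding basic_assumptions_def M0_of_tilted[OF A E0C1 F, of N0]
  proof (intro conjI exI[of _ "\<lambda>T q G. D0 T q (F + G)"])
    show "\<forall>\<epsilon>>0. gradient_system A g (E \<epsilon> + F) (R \<epsilon>)"
      by (intro allI impI) (rule gradient)
    show "\<forall>T>0. \<forall>G\<in>C1_functions A. Gamma_converges (C_topology T)
        (\<lambda>\<epsilon>. extend_by_infinity A T (\<lambda>q. dissipation_functional A (E \<epsilon> + F) (R \<epsilon>) T q G))
        (extend_by_infinity A T (\<lambda>q. D0 T q (F + G)))"
      by (intro allI impI ballI) (rule functionals)
    show "\<forall>T>0. \<forall>G\<in>C1_functions A. \<forall>q\<in>AC_curves A T. D0 T q (F + G) =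
        (\<integral>\<^sup>+ t. N0 (q t) (velocity A q t) (- differential A G (q t) - differential A F (q t))
          \<partial>lebesgue_on {0..T})"
      by (intro allI impI ballI) (rule integral)
    show "\<forall>q. \<forall>\<eta>\<in>cotangent_space A q.
        convex_fun_on (tangent_space A q) (\<lambda>v. N0 q v (\<eta> - differential A F q)) \<and>
        lsc_on (tangent_space A q) (\<lambda>v. N0 q v (\<eta> - differential A F q))"
      by (intro allI ballI) (rule convex_lsc)
  qed (rule energies M0)+
qed

lemma tilt_EDP_converges_tilted:
  assumes conv: "tilt_EDP_converges A g E R E0 R0" and F: "F \<in> C1_functions A"
  shows "tilt_EDP_converges A g (\<lambda>\<epsilon>. E \<epsilon> + F) R (E0 + F) R0"
proof -
  have grad: "gradient_system A g E0 R0"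
    using conv by (simp add: tilt_EDP_converges_def)
  then have A: "smooth_manifold A" and E0: "E0 \<in> C1_functions A"
    by (auto simp: gradient_system_def riemannian_manifold_def)
  obtain N0 where "basic_assumptions A g E R E0 N0"
    and "\<forall>q. \<forall>v\<in>tangent_space A q. \<forall>\<xi>\<in>cotangent_space A q.
      M0_of A E0 N0 q v \<xi> = R0 q v + dual_potential A R0 q \<xi>"
    using conv unfolding tilt_EDP_converges_def by blast
  then show ?thesis
    unfolding tilt_EDP_converges_def
    using gradient_system_tilted[OF grad F] basic_assumptions_tilted[OF _ grad F]
      M0_of_tilted[OF A E0 F, of N0]
    by (intro conjI exI[of _ "\<lambda>q v \<eta>. N0 q v (\<eta> - differential A F q)"]) simp_all
qed

lemma contact_EDP_converges_tilted:
  assumes conv: "contact_EDP_converges A g E R E0 R0" and F: "F \<in> C1_functions A"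
  shows "contact_EDP_converges A g (\<lambda>\<epsilon>. E \<epsilon> + F) R (E0 + F) R0"
proof -
  have grad: "gradient_system A g E0 R0"
    using conv by (simp add: contact_EDP_converges_def)
  then have A: "smooth_manifold A" and E0: "E0 \<in> C1_functions A"
    by (auto simp: gradient_system_def riemannian_manifold_def)
  obtain N0 where "basic_assumptions A g E R E0 N0"
    and "\<forall>q. {(v, \<xi>). v \<in> tangent_space A q \<and> \<xi> \<in> cotangent_space A q \<and>
        enn2ereal (M0_of A E0 N0 q v \<xi>) = ereal (\<xi> v)} =
      {(v, \<xi>). v \<in> tangent_space A q \<and> \<xi> \<in> subdifferential A R0 q v}"
    using conv unfolding contact_EDP_converges_def by blast
  then show ?thesis
    unfolding contact_EDP_converges_def
    using gradient_system_tilted[OF grad F] basic_assumptions_tilted[OF _ grad F]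
      M0_of_tilted[OF A E0 F, of N0]
    by (intro conjI exI[of _ "\<lambda>q v \<eta>. N0 q v (\<eta> - differential A F q)"]) simp_all
qed

theorem lemma2p17:
  fixes A :: "('q::{t2_space, second_countable_topology}, 'e::real_normed_vector) chart set"
    and g :: "'q \<Rightarrow> ('q, 'e) tvec \<Rightarrow> ('q, 'e) tvec \<Rightarrow> real"
    and E :: "real \<Rightarrow> 'q \<Rightarrow> real" and R :: "real \<Rightarrow> 'q \<Rightarrow> ('q, 'e) tvec \<Rightarrow> ennreal"
    and E0 :: "'q \<Rightarrow> real" and R0 :: "'q \<Rightarrow> ('q, 'e) tvec \<Rightarrow> ennreal"
  assumes "EDP_converges \<in> {tilt_EDP_converges, contact_EDP_converges}"
    and "\<And>\<epsilon>. 0 < \<epsilon> \<Longrightarrow> gradient_system A g (E \<epsilon>) (R \<epsilon>)"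
    and "gradient_system A g E0 R0"
    and "EDP_converges A g E R E0 R0"
  shows "\<forall>F\<in>C1_functions A. EDP_converges A g (\<lambda>\<epsilon>. E \<epsilon> + F) R (E0 + F) R0"
  using assms(1,4) tilt_EDP_converges_tilted contact_EDP_converges_tilted by auto

end
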